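(* Let $s\ge1$ and $\mathbf{r}=(r_{1},\dots,r_{s})\in\mathbb{R}^{s}$. For $n\ge1$ define $$Q_{n}^{\mathbf{r}}(\underline{x}):=\frac{1}{n!}\sum_{\sigma\in S_{n}}\det(I_{n}-x_{1}M_{\sigma})^{r_{1}}\cdots\det(I_{n}-x_{s}M_{\sigma})^{r_{s}}\in\mathbb{R}\llbracket x_1,\dots,x_s\rrbracket,$$ and set $Q_0^{\mathbf{r}}(\underline{x}):=1$. Let $h(\underline{x}):=(1-x_{1})^{r_{1}}\cdots(1-x_{s})^{r_{s}}$. Then, for every $n\ge1$, as elements of $\mathbb{R}\llbracket x_1,\dots,x_s\rrbracket$, $$Q_{n}^{\mathbf{r}}(\underline{x})=\frac{1}{n}\sum_{k=1}^{n}h(\underline{x}^{k})\,Q_{n-k}^{\mathbf{r}}(\underline{x}).$$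
   Context: $S_n$ is the symmetric group on $n$ letters, $M_\sigma$ the $n\times n$ permutation matrix of $\sigma\in S_n$, $I_n$ the $n\times n$ identity matrix. Notation: $\underline{x}=(x_1,\dots,x_s)$ and $\underline{x}^k=(x_1^k,\dots,x_s^k)$, so $h(\underline{x}^k)=(1-x_1^k)^{r_1}\cdots(1-x_s^k)^{r_s}$. For a formal power series $1+u$ with $u$ of zero constant term and $a\in\mathbb{R}$, $(1+u)^a:=\sum_{m\ge0}\binom{a}{m}u^m$ with $\binom{a}{m}=\frac{a(a-1)\cdots(a-m+1)}{m!}$; this is applied to $\det(I_n-x_iM_\sigma)$, which has constant term $1$, and to $1-x_i$. *)

theory Defs
  imports Complex_Main "Jordan_Normal_Form.Determinant"
begin

section \<open>Formal power series in finitely many variables\<close>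

text \<open>
  The variables are indexed by a finite type \<open>'v\<close>, so the number of variables is the cardinality
  of \<open>'v\<close>. A monomial is given by its exponent vector \<open>\<alpha> :: 'v \<Rightarrow> nat\<close>, and a series is the
  family of its coefficients.
\<close>

typedef ('v, 'a) mfps = "UNIV :: (('v \<Rightarrow> nat) \<Rightarrow> 'a) set"
  morphisms mfps_nth Abs_mfps ..

setup_lifting type_definition_mfps

lemma mfps_eq_iff: "f = g \<longleftrightarrow> (\<forall>\<alpha>. mfps_nth f \<alpha> = mfps_nth g \<alpha>)"
  by (auto simp: mfps_nth_inject[symmetric])

instantiation mfps :: (type, ab_group_add) ab_group_add
begin

lift_definition zero_mfps :: "('a, 'b) mfps" is "\<lambda>_. 0" .

lift_definition plus_mfps :: "('a, 'b) mfps \<Rightarrow> ('a, 'b) mfps \<Rightarrow> ('a, 'b) mfps"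
  is "\<lambda>f g \<alpha>. f \<alpha> + g \<alpha>" .

lift_definition minus_mfps :: "('a, 'b) mfps \<Rightarrow> ('a, 'b) mfps \<Rightarrow> ('a, 'b) mfps"
  is "\<lambda>f g \<alpha>. f \<alpha> - g \<alpha>" .

lift_definition uminus_mfps :: "('a, 'b) mfps \<Rightarrow> ('a, 'b) mfps"
  is "\<lambda>f \<alpha>. - f \<alpha>" .

instance
  by standard (transfer; auto simp: fun_eq_iff algebra_simps)+

end

lemma finite_exponents_le [simp]: "finite {\<beta> :: 'v::finite \<Rightarrow> nat. \<beta> \<le> \<alpha>}"
proof -
  have "{\<beta>. \<beta> \<le> \<alpha>} = Pi\<^sub>E UNIV (\<lambda>i. {..\<alpha> i})"
    by (auto simp: le_fun_def PiE_def)
  thus ?thesis by (simp add: finite_PiE)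
qed

instantiation mfps :: (finite, comm_ring_1) comm_ring_1
begin

lift_definition one_mfps :: "('a, 'b) mfps" is "\<lambda>\<alpha>. if \<alpha> = (\<lambda>_. 0) then 1 else 0" .

lift_definition times_mfps :: "('a, 'b) mfps \<Rightarrow> ('a, 'b) mfps \<Rightarrow> ('a, 'b) mfps"
  is "\<lambda>f g \<alpha>. \<Sum>\<beta> | \<beta> \<le> \<alpha>. f \<beta> * g (\<lambda>i. \<alpha> i - \<beta> i)" .

instance
proof
  fix a b c :: "('a, 'b) mfps"
  show "a * b * c = a * (b * c)"
  proof (transfer, rule ext)
    fix a b c :: "('a \<Rightarrow> nat) \<Rightarrow> 'b" and \<alpha> :: "'a \<Rightarrow> nat"
    have "(\<Sum>\<beta> | \<beta> \<le> \<alpha>. (\<Sum>\<gamma> | \<gamma> \<le> \<beta>. a \<gamma> * b (\<lambda>i. \<beta> i - \<gamma> i)) * c (\<lambda>i. \<alpha> i - \<beta> i)) =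
      (\<Sum>(\<beta>, \<gamma>) \<in> Sigma {\<beta>. \<beta> \<le> \<alpha>} (\<lambda>\<beta>. {\<gamma>. \<gamma> \<le> \<beta>}).
          a \<gamma> * b (\<lambda>i. \<beta> i - \<gamma> i) * c (\<lambda>i. \<alpha> i - \<beta> i))"
      by (simp add: sum.Sigma sum_distrib_right)
    also have "\<dots> = (\<Sum>(\<gamma>, \<delta>) \<in> Sigma {\<gamma>. \<gamma> \<le> \<alpha>} (\<lambda>\<gamma>. {\<delta>. \<delta> \<le> (\<lambda>i. \<alpha> i - \<gamma> i)}).
          a \<gamma> * (b \<delta> * c (\<lambda>i. \<alpha> i - \<gamma> i - \<delta> i)))"
    proof (rule sum.reindex_bij_witness
        [where j = "\<lambda>(\<beta>, \<gamma>). (\<gamma>, \<lambda>i. \<beta> i - \<gamma> i)" and i = "\<lambda>(\<gamma>, \<delta>). (\<lambda>i. \<gamma> i + \<delta> i, \<gamma>)"],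
        goal_cases)
      case (1 p)
      then show ?case by (auto simp: le_fun_def fun_eq_iff)
    next
      case (2 p)
      then show ?case by (auto simp: le_fun_def intro: order_trans diff_le_mono)
    next
      case (3 p)
      then show ?case by (auto simp: le_fun_def fun_eq_iff)
    next
      case (4 p)
      then show ?case
        by (auto simp: le_fun_def) (metis le_diff_conv2 add.commute diff_add_inverse le_add1
            le_add_diff_inverse nat_add_left_cancel_le)
    next
      case (5 p)
      obtain \<beta> \<gamma> where p: "p = (\<beta>, \<gamma>)" by fastforce
      have "(\<lambda>i. \<alpha> i - \<gamma> i - (\<beta> i - \<gamma> i)) = (\<lambda>i. \<alpha> i - \<beta> i)"
        using 5 by (auto simp: p le_fun_def fun_eq_iff)
      then show ?case by (simp add: p mult.assoc)
    qed
    also have "\<dots> = (\<Sum>\<gamma> | \<gamma> \<le> \<alpha>. a \<gamma> *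
        (\<Sum>\<delta> | \<delta> \<le> (\<lambda>i. \<alpha> i - \<gamma> i). b \<delta> * c (\<lambda>i. \<alpha> i - \<gamma> i - \<delta> i)))"
      by (simp add: sum.Sigma sum_distrib_left)
    finally show "(\<Sum>\<beta> | \<beta> \<le> \<alpha>. (\<Sum>\<gamma> | \<gamma> \<le> \<beta>. a \<gamma> * b (\<lambda>i. \<beta> i - \<gamma> i)) * c (\<lambda>i. \<alpha> i - \<beta> i)) =
      (\<Sum>\<gamma> | \<gamma> \<le> \<alpha>. a \<gamma> *
        (\<Sum>\<delta> | \<delta> \<le> (\<lambda>i. \<alpha> i - \<gamma> i). b \<delta> * c (\<lambda>i. \<alpha> i - \<gamma> i - \<delta> i)))" .
  qed
  show "a * b = b * a"
  proof (transfer, rule ext)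
    fix a b :: "('a \<Rightarrow> nat) \<Rightarrow> 'b" and \<alpha> :: "'a \<Rightarrow> nat"
    show "(\<Sum>\<beta> | \<beta> \<le> \<alpha>. a \<beta> * b (\<lambda>i. \<alpha> i - \<beta> i)) = (\<Sum>\<beta> | \<beta> \<le> \<alpha>. b \<beta> * a (\<lambda>i. \<alpha> i - \<beta> i))"
      by (rule sum.reindex_bij_witness[where i = "\<lambda>\<beta> i. \<alpha> i - \<beta> i" and j = "\<lambda>\<beta> i. \<alpha> i - \<beta> i"])
         (auto simp: le_fun_def mult.commute)
  qed
  show "1 * a = a"
  proof (transfer, rule ext)
    fix a :: "('a \<Rightarrow> nat) \<Rightarrow> 'b" and \<alpha> :: "'a \<Rightarrow> nat"
    have "(\<Sum>\<beta> | \<beta> \<le> \<alpha>. (if \<beta> = (\<lambda>_. 0) then 1 else 0) * a (\<lambda>i. \<alpha> i - \<beta> i)) =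
      (\<Sum>\<beta> | \<beta> \<le> \<alpha>. if \<beta> = (\<lambda>_. 0) then a \<alpha> else 0)"
      by (intro sum.cong) auto
    also have "\<dots> = a \<alpha>"
      by (subst sum.delta[OF finite_exponents_le]) (simp add: le_fun_def)
    finally show "(\<Sum>\<beta> | \<beta> \<le> \<alpha>. (if \<beta> = (\<lambda>_. 0) then 1 else 0) * a (\<lambda>i. \<alpha> i - \<beta> i)) = a \<alpha>" .
  qed
  show "(a + b) * c = a * c + b * c"
    by transfer (simp add: fun_eq_iff algebra_simps sum.distrib)
  show "(0 :: ('a, 'b) mfps) \<noteq> 1"
    by transfer (auto simp: fun_eq_iff)
qed

end

lift_definition mfps_const :: "'a::zero \<Rightarrow> ('v, 'a) mfps"
  is "\<lambda>c \<alpha>. if \<alpha> = (\<lambda>_. 0) then c else 0" .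

lift_definition mfps_X :: "'v \<Rightarrow> ('v, 'a::zero_neq_one) mfps"
  is "\<lambda>i \<alpha>. if \<alpha> = (\<lambda>j. if j = i then 1 else 0) then 1 else 0" .


section \<open>Real powers of series with constant term \<open>1\<close>\<close>

text \<open>
  For \<open>f = 1 + u\<close>, this is the series \<open>\<Sum>m. (a gchoose m) * u ^ m\<close>, summed coefficientwise.
  It is meant for \<open>u\<close> with zero constant term; then, for each \<open>\<alpha>\<close>, only finitely many summands are
  nonzero, as the two lemmas below confirm.
\<close>

definition mfps_rpow :: "('v::finite, real) mfps \<Rightarrow> real \<Rightarrow> ('v, real) mfps" where
  "mfps_rpow f a = Abs_mfps (\<lambda>\<alpha>. \<Sum>m. (a gchoose m) * mfps_nth ((f - 1) ^ m) \<alpha>)"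

lemma mfps_nth_power_eq_0:
  fixes u :: "('v::finite, 'a::comm_ring_1) mfps"
  assumes "mfps_nth u (\<lambda>_. 0) = 0" "(\<Sum>i\<in>UNIV. \<alpha> i) < m"
  shows "mfps_nth (u ^ m) \<alpha> = 0"
  using assms(2)
proof (induction m arbitrary: \<alpha>)
  case (Suc m)
  have "mfps_nth u \<beta> * mfps_nth (u ^ m) (\<lambda>i. \<alpha> i - \<beta> i) = 0" if le: "\<beta> \<le> \<alpha>" for \<beta>
  proof (cases "\<beta> = (\<lambda>_. 0)")
    case False
    then obtain j where j: "\<beta> j > 0" by (auto simp: fun_eq_iff)
    have "(\<Sum>i\<in>UNIV. \<alpha> i - \<beta> i) < (\<Sum>i\<in>UNIV. \<alpha> i)"
      using j le by (intro sum_strict_mono_ex1) (auto simp: le_fun_def intro!: exI[of _ j]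
          diff_less order_less_le_trans[OF j])
    with Suc show ?thesis by simp
  qed (use assms(1) in simp)
  thus ?case by (simp add: times_mfps.rep_eq)
qed simp

lemma mfps_nth_rpow:
  assumes "mfps_nth f (\<lambda>_. 0) = 1"
  shows "mfps_nth (mfps_rpow f a) \<alpha> =
           (\<Sum>m\<le>(\<Sum>i\<in>UNIV. \<alpha> i). (a gchoose m) * mfps_nth ((f - 1) ^ m) \<alpha>)"
proof -
  have "mfps_nth (f - 1) (\<lambda>_. 0) = 0"
    using assms by (simp add: minus_mfps.rep_eq one_mfps.rep_eq)
  hence "mfps_nth ((f - 1) ^ m) \<alpha> = 0" if "m \<notin> {..\<Sum>i\<in>UNIV. \<alpha> i}" for m
    using that by (intro mfps_nth_power_eq_0) auto
  hence "(\<Sum>m. (a gchoose m) * mfps_nth ((f - 1) ^ m) \<alpha>) =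
      (\<Sum>m\<le>(\<Sum>i\<in>UNIV. \<alpha> i). (a gchoose m) * mfps_nth ((f - 1) ^ m) \<alpha>)"
    by (intro suminf_finite) simp_all
  thus ?thesis
    by (simp add: mfps_rpow_def Abs_mfps_inverse)
qed


section \<open>The averages over the symmetric group\<close>

text \<open>
  Rows and columns are numbered from \<open>0\<close>, so the symmetric group acts on \<open>{..<n}\<close>. The
  argument of \<open>h_series\<close> is the tuple of series that is substituted for the variables of \<open>h\<close>.
\<close>

definition perm_matrix :: "nat \<Rightarrow> (nat \<Rightarrow> nat) \<Rightarrow> 'a::zero_neq_one mat" where
  "perm_matrix n \<sigma> = mat n n (\<lambda>(i, j). if i = \<sigma> j then 1 else 0)"

definition h_series :: "('v::finite \<Rightarrow> real) \<Rightarrow> ('v \<Rightarrow> ('v, real) mfps) \<Rightarrow> ('v, real) mfps" where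
  "h_series r x = (\<Prod>i\<in>UNIV. mfps_rpow (1 - x i) (r i))"

definition Q_series :: "('v::finite \<Rightarrow> real) \<Rightarrow> nat \<Rightarrow> ('v, real) mfps" where
  "Q_series r n = (if n = 0 then 1 else
     mfps_const (1 / fact n) *
     (\<Sum>\<sigma> | \<sigma> permutes {..<n}. \<Prod>i\<in>UNIV.
        mfps_rpow (det (1\<^sub>m n - mfps_X i \<cdot>\<^sub>m perm_matrix n \<sigma>)) (r i)))"

end

theory Submission
  imports Defs
begin

text \<open>
  Give each point \<open>j\<close> a weight \<open>m j > 0\<close> and scale row \<open>j\<close> of the permutation matrix by
  \<open>x ^ m j\<close>. Writing a permutation of \<open>{..n}\<close> as \<open>transpose n b \<circ> \<tau>\<close> with \<open>\<tau>\<close> fixing \<open>n\<close>,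
  one can eliminate \<open>n\<close> from the determinant: if \<open>b = n\<close>, a factor \<open>1 - x ^ m n\<close> splits off;
  otherwise \<open>n\<close> is contracted into \<open>b\<close>, whose weight becomes \<open>m b + m n\<close>. Let \<open>P n\<close> be the sum
  over \<open>S\<^sub>n\<close> with unit weights and \<open>G n w\<close> the one over \<open>S\<^sub>n\<^sub>+\<^sub>1\<close> with one weight changed to \<open>w\<close>.
  Then \<open>G n w = h (x ^ w) P n + n G (n - 1) (w + 1)\<close>, and iterating this from \<open>P n = G (n - 1) 1\<close>
  gives the claim, without any cycle decomposition.
\<close>

section \<open>Real powers\<close>

text \<open>Through \<open>hom_det\<close>, the constant term of a determinant becomes the
  determinant of the constant terms.\<close>

interpretation mfps_const_term:
  comm_ring_hom "\<lambda>f :: ('v::finite, 'a::comm_ring_1) mfps. mfps_nth f (\<lambda>_. 0)"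
proof
  fix f g :: "('v, 'a) mfps"
  have "{\<beta> :: 'v \<Rightarrow> nat. \<beta> \<le> (\<lambda>_. 0)} = {\<lambda>_. 0}"
    by (auto simp: le_fun_def)
  then show "mfps_nth (f * g) (\<lambda>_. 0) = mfps_nth f (\<lambda>_. 0) * mfps_nth g (\<lambda>_. 0)"
    by (simp add: times_mfps.rep_eq)
qed (simp_all add: plus_mfps.rep_eq one_mfps.rep_eq zero_mfps.rep_eq)

lemma mfps_nth_sum: "mfps_nth (sum f A) \<alpha> = (\<Sum>x\<in>A. mfps_nth (f x) \<alpha>)"
  by (induction A rule: infinite_finite_induct) (auto simp: plus_mfps.rep_eq zero_mfps.rep_eq)

lemma mfps_nth_of_nat_mult:
  fixes f :: "('v::finite, 'a::comm_ring_1) mfps"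
  shows "mfps_nth (of_nat k * f) \<alpha> = of_nat k * mfps_nth f \<alpha>"
  by (induction k) (auto simp: plus_mfps.rep_eq zero_mfps.rep_eq algebra_simps)

lemma mfps_const_mult:
  "mfps_const (a * b) = (mfps_const a * mfps_const b :: ('v::finite, 'a::comm_ring_1) mfps)"
proof -
  have "(\<Sum>\<beta> | \<beta> \<le> \<alpha>. (if \<beta> = (\<lambda>_. 0) then a else 0) *
      (if (\<lambda>i. \<alpha> i - \<beta> i) = (\<lambda>_. 0) then b else 0)) =
    (\<Sum>\<beta> | \<beta> \<le> \<alpha>. if \<beta> = (\<lambda>_. 0) then (if \<alpha> = (\<lambda>_. 0) then a * b else 0) else 0)"
    for \<alpha> :: "'v \<Rightarrow> nat"
    by (rule sum.cong) auto
  also have "\<dots> \<alpha> = (if \<alpha> = (\<lambda>_. 0) then a * b else 0)" for \<alpha> :: "'v \<Rightarrow> nat"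
    by (subst sum.delta[OF finite_exponents_le]) (auto simp: le_fun_def)
  finally show ?thesis
    by (simp add: mfps_eq_iff times_mfps.rep_eq mfps_const.rep_eq)
qed

lemma mfps_const_of_nat:
  "mfps_const (of_nat k) = (of_nat k :: ('v::finite, 'a::comm_ring_1) mfps)"
  using mfps_nth_of_nat_mult[of k "1 :: ('v, 'a) mfps"]
  by (auto simp: mfps_eq_iff mfps_const.rep_eq one_mfps.rep_eq)

lemma mfps_const_1: "mfps_const 1 = (1 :: ('v::finite, 'a::comm_ring_1) mfps)"
  using mfps_const_of_nat[of 1] by simp

section \<open>Coefficients of real powers as polynomials in the exponent\<close>

definition gbinomial_poly :: "nat \<Rightarrow> real poly" where
  "gbinomial_poly m = smult (1 / fact m) (\<Prod>i<m. [:- of_nat i, 1:])"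

lemma poly_gbinomial_poly: "poly (gbinomial_poly m) a = a gchoose m"
  by (simp add: gbinomial_poly_def poly_prod gbinomial_prod_rev atLeast0LessThan)

text \<open>For constant term 1 the binomial series stops at the total degree of \<alpha>, whatever
  the exponent, so the sum has a fixed finite range.\<close>

definition rpow_poly :: "('v::finite, real) mfps \<Rightarrow> ('v \<Rightarrow> nat) \<Rightarrow> real poly" where
  "rpow_poly f \<alpha> =
     (\<Sum>m\<le>(\<Sum>i\<in>UNIV. \<alpha> i). smult (mfps_nth ((f - 1) ^ m) \<alpha>) (gbinomial_poly m))"

lemma poly_rpow_poly:
  assumes "mfps_nth f (\<lambda>_. 0) = 1"
  shows "poly (rpow_poly f \<alpha>) a = mfps_nth (mfps_rpow f a) \<alpha>"
  by (simp add: rpow_poly_def poly_sum poly_gbinomial_poly mfps_nth_rpow[OF assms] mult.commute)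

lemma poly_eqI_of_nat:
  fixes p q :: "real poly"
  assumes "\<And>k. poly p (of_nat k) = poly q (of_nat k)"
  shows "p = q"
proof (rule ccontr)
  assume "p \<noteq> q"
  then have "finite {x. poly (p - q) x = 0}"
    by (intro poly_roots_finite) auto
  moreover have "range of_nat \<subseteq> {x. poly (p - q) x = 0}"
    using assms by auto
  ultimately have "finite (range (of_nat :: nat \<Rightarrow> real))"
    by (rule rev_finite_subset)
  then show False
    by (simp add: finite_image_iff inj_of_nat)
qed

lemma mfps_rpow_of_nat:
  assumes f: "mfps_nth f (\<lambda>_. 0) = 1"
  shows "mfps_rpow f (of_nat k) = f ^ k"
proof -
  have "mfps_nth (mfps_rpow f (of_nat k)) \<alpha> = mfps_nth (f ^ k) \<alpha>" for \<alpha>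
  proof -
    define c where "c m = of_nat (k choose m) * mfps_nth ((f - 1) ^ m) \<alpha>" for m
    define N where "N = (\<Sum>i\<in>UNIV. \<alpha> i)"
    have u: "mfps_nth (f - 1) (\<lambda>_. 0) = 0"
      using f by (simp add: minus_mfps.rep_eq one_mfps.rep_eq)
    have "mfps_nth (mfps_rpow f (of_nat k)) \<alpha> = (\<Sum>m\<le>N. c m)"
      by (simp add: mfps_nth_rpow[OF f] c_def N_def binomial_gbinomial)
    \<comment> \<open>Two truncations are compared: the coefficient at \<alpha> vanishes for
      \<open>m > N\<close>, and \<open>k choose m\<close> vanishes for \<open>m > k\<close>.\<close>
    also have "\<dots> = (\<Sum>m\<le>max k N. c m)"
      by (intro sum.mono_neutral_left)
        (auto simp: c_def N_def intro!: mfps_nth_power_eq_0[OF u])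
    also have "\<dots> = (\<Sum>m\<le>k. c m)"
      by (intro sum.mono_neutral_right) (auto simp: c_def binomial_eq_0)
    also have "\<dots> = mfps_nth (((f - 1) + 1) ^ k) \<alpha>"
      by (subst binomial_ring) (simp add: c_def mfps_nth_sum mfps_nth_of_nat_mult)
    finally show ?thesis by simp
  qed
  then show ?thesis by (simp add: mfps_eq_iff)
qed

text \<open>
  Both sides have coefficients that are polynomials in the exponent, and they agree for every
  natural exponent.
\<close>

lemma mfps_rpow_mult:
  assumes f: "mfps_nth f (\<lambda>_. 0) = 1" and g: "mfps_nth g (\<lambda>_. 0) = 1"
  shows "mfps_rpow (f * g) a = mfps_rpow f a * mfps_rpow g a"
proof -
  have fg: "mfps_nth (f * g) (\<lambda>_. 0) = 1"
    using f g by (simp add: mfps_const_term.hom_mult)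
  have "mfps_nth (mfps_rpow (f * g) a) \<alpha> = mfps_nth (mfps_rpow f a * mfps_rpow g a) \<alpha>" for \<alpha>
  proof -
    let ?q = "\<Sum>\<beta> | \<beta> \<le> \<alpha>. rpow_poly f \<beta> * rpow_poly g (\<lambda>i. \<alpha> i - \<beta> i)"
    have q: "poly ?q b = mfps_nth (mfps_rpow f b * mfps_rpow g b) \<alpha>" for b
      by (simp add: poly_sum poly_rpow_poly[OF f] poly_rpow_poly[OF g] times_mfps.rep_eq)
    have "rpow_poly (f * g) \<alpha> = ?q"
      by (rule poly_eqI_of_nat)
        (simp add: q poly_rpow_poly[OF fg] mfps_rpow_of_nat[OF f] mfps_rpow_of_nat[OF g]
          mfps_rpow_of_nat[OF fg] power_mult_distrib del: poly_sum)
    then show ?thesis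
      using q[of a] poly_rpow_poly[OF fg, of \<alpha> a] by simp
  qed
  then show ?thesis by (simp add: mfps_eq_iff)
qed

lemma mfps_rpow_1: "mfps_rpow 1 a = (1 :: ('v::finite, real) mfps)"
proof -
  have "(\<Sum>m. (a gchoose m) * mfps_nth (0 ^ m :: ('v::finite, real) mfps) \<alpha>) =
      (\<Sum>m\<in>{0}. (a gchoose m) * mfps_nth (0 ^ m :: ('v::finite, real) mfps) \<alpha>)" for \<alpha>
    by (intro suminf_finite) (auto simp: zero_mfps.rep_eq power_0_left)
  then show ?thesis
    by (simp add: mfps_eq_iff mfps_rpow_def Abs_mfps_inverse)
qed

section \<open>Weighted permutation matrices\<close>

text \<open>This is I - D M with D = diag(y) and M the permutation matrix of \<sigma>.\<close>

definition weighted_perm_matrix ::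
  "nat \<Rightarrow> (nat \<Rightarrow> 'a) \<Rightarrow> (nat \<Rightarrow> nat) \<Rightarrow> 'a::comm_ring_1 mat" where
  "weighted_perm_matrix n y \<sigma> =
     mat n n (\<lambda>(i, j). (if i = j then 1 else 0) - (if i = \<sigma> j then y i else 0))"

lemma weighted_perm_matrix_carrier [simp]: "weighted_perm_matrix n y \<sigma> \<in> carrier_mat n n"
  and weighted_perm_matrix_dim [simp]:
    "dim_row (weighted_perm_matrix n y \<sigma>) = n" "dim_col (weighted_perm_matrix n y \<sigma>) = n"
  by (simp_all add: weighted_perm_matrix_def)

lemma weighted_perm_matrix_index [simp]:
  "i < n \<Longrightarrow> j < n \<Longrightarrow> weighted_perm_matrix n y \<sigma> $$ (i, j) =
     (if i = j then 1 else 0) - (if i = \<sigma> j then y i else 0)"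
  by (simp add: weighted_perm_matrix_def)

lemma det_last_column:
  fixes A :: "'a::comm_ring_1 mat"
  assumes A: "A \<in> carrier_mat (Suc n) (Suc n)" and z: "\<And>i. i < n \<Longrightarrow> A $$ (i, n) = 0"
  shows "det A = A $$ (n, n) * det (mat n n (\<lambda>(i, j). A $$ (i, j)))"
proof -
  have "det A = (\<Sum>i<Suc n. A $$ (i, n) * cofactor A i n)"
    by (rule laplace_expansion_column[OF A]) simp
  also have "\<dots> = A $$ (n, n) * cofactor A n n"
    using z by simp
  also have "cofactor A n n = det (mat_delete A n n)"
    by (simp add: cofactor_def)
  also have "mat_delete A n n = mat n n (\<lambda>(i, j). A $$ (i, j))"
    using A by (intro eq_matI) (auto simp: mat_delete_def)
  finally show ?thesis .
qed

text \<open>As \<tau> fixes \<open>n\<close>, column \<open>n\<close> vanishes except for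
  \<open>1 - y n\<close> on the diagonal.\<close>

lemma det_weighted_fixed:
  assumes \<tau>: "\<tau> permutes {..<n}"
  shows "det (weighted_perm_matrix (Suc n) y \<tau>) = (1 - y n) * det (weighted_perm_matrix n y \<tau>)"
proof -
  have n: "\<tau> n = n"
    using \<tau> by (simp add: permutes_not_in)
  have "mat n n (\<lambda>(i, j). weighted_perm_matrix (Suc n) y \<tau> $$ (i, j)) = weighted_perm_matrix n y \<tau>"
    by (intro eq_matI) auto
  then show ?thesis
    using n by (subst det_last_column[of _ n]) auto
qed

text \<open>
  Adding \<open>y b\<close> times row \<open>n\<close> to row \<open>b\<close> clears column \<open>n\<close>: this removes \<open>n\<close> from its cycle and
  passes its weight to \<open>b\<close>.
\<close>

lemma det_weighted_contract:
  assumes \<tau>: "\<tau> permutes {..<n}" and b: "b < n"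
  shows "det (weighted_perm_matrix (Suc n) y (transpose n b \<circ> \<tau>)) =
         det (weighted_perm_matrix n (y(b := y b * y n)) \<tau>)"
proof -
  let ?A = "weighted_perm_matrix (Suc n) y (transpose n b \<circ> \<tau>)"
  let ?B = "addrow (y b) b n ?A"
  have n: "\<tau> n = n"
    using \<tau> by (simp add: permutes_not_in)
  have ne: "\<tau> j \<noteq> n" "n \<noteq> \<tau> j" if "j < n" for j
    using permutes_in_image[OF \<tau>, of j] that by auto
  have "det ?A = det ?B"
    using b by (subst det_addrow[of _ "Suc n"]) auto
  also have "\<dots> = ?B $$ (n, n) * det (mat n n (\<lambda>(i, j). ?B $$ (i, j)))"
    using b n by (intro det_last_column) (auto simp: mat_addrow_def transpose_def)
  also have "?B $$ (n, n) = 1"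
    using b n by (simp add: mat_addrow_def)
  \<comment> \<open>Left of column \<open>n\<close>, row \<open>b\<close> of \<open>?A\<close> has
    only its diagonal 1, since \<open>\<tau> j \<noteq> n\<close>. Row \<open>n\<close> has
    \<open>- y n\<close> where \<open>\<tau> j = b\<close>, which contributes the entry
    \<open>- y b * y n\<close>.\<close>
  also have "mat n n (\<lambda>(i, j). ?B $$ (i, j)) = weighted_perm_matrix n (y(b := y b * y n)) \<tau>"
    using b by (intro eq_matI) (auto simp: mat_addrow_def transpose_def ne)
  finally show ?thesis by (simp only: mult_1)
qed

text \<open>Conjugation renames the points: rows and columns are both permuted by \<open>p\<close>,
  and the two signs cancel.\<close>

lemma det_weighted_conj:
  assumes p: "p permutes {..<n}"
  shows "det (weighted_perm_matrix n (y \<circ> p) (Hilbert_Choice.inv p \<circ> \<tau> \<circ> p)) = det (weighted_perm_matrix n y \<tau>)"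
proof -
  let ?A = "weighted_perm_matrix n y \<tau>"
  let ?R = "mat n n (\<lambda>(i, j). ?A $$ (p i, j))"
  have p0: "p permutes {0..<n}"
    using p by (simp add: atLeast0LessThan)
  have lt: "p j < n" if "j < n" for j
    using permutes_in_image[OF p, of j] that by simp
  have eq: "i = Hilbert_Choice.inv p x \<longleftrightarrow> p i = x" for i x
    using permutes_inverses[OF p] by metis
  have inj: "p i = p j \<longleftrightarrow> i = j" for i j
    using permutes_inj[OF p] by (auto dest: injD)
  \<comment> \<open>\<open>det_permute_rows\<close> acts on rows, so the columns are permuted
    between two matrix transposes.\<close>
  have "weighted_perm_matrix n (y \<circ> p) (Hilbert_Choice.inv p \<circ> \<tau> \<circ> p) =
      transpose_mat (mat n n (\<lambda>(i, j). transpose_mat ?R $$ (p i, j)))"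
    by (intro eq_matI) (auto simp: lt eq inj)
  then have "det (weighted_perm_matrix n (y \<circ> p) (Hilbert_Choice.inv p \<circ> \<tau> \<circ> p)) =
      det (mat n n (\<lambda>(i, j). transpose_mat ?R $$ (p i, j)))"
    by (simp add: det_transpose[of _ n])
  also have "\<dots> = signof p * det (transpose_mat ?R)"
    by (intro det_permute_rows p0) simp
  also have "det (transpose_mat ?R) = det ?R"
    by (intro det_transpose[of _ n]) simp
  also have "det ?R = signof p * det ?A"
    by (intro det_permute_rows p0) simp
  also have "signof p * (signof p * det ?A) = det ?A"
    by (simp add: sign_def)
  finally show ?thesis .
qed

text \<open>The matrix of constant terms is the identity.\<close>

lemma det_weighted_const_term:
  fixes y :: "nat \<Rightarrow> ('v::finite, 'a::comm_ring_1) mfps"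
  assumes "\<And>i. i < n \<Longrightarrow> mfps_nth (y i) (\<lambda>_. 0) = 0"
  shows "mfps_nth (det (weighted_perm_matrix n y \<sigma>)) (\<lambda>_. 0) = 1"
proof -
  have "map_mat (\<lambda>f. mfps_nth f (\<lambda>_. 0)) (weighted_perm_matrix n y \<sigma>) = 1\<^sub>m n"
    using assms by (intro eq_matI)
      (auto simp: minus_mfps.rep_eq one_mfps.rep_eq zero_mfps.rep_eq)
  then show ?thesis
    by (simp flip: mfps_const_term.hom_det)
qed

section \<open>The recursion\<close>

definition weighted_term ::
  "('v::finite \<Rightarrow> real) \<Rightarrow> nat \<Rightarrow> (nat \<Rightarrow> nat) \<Rightarrow> (nat \<Rightarrow> nat) \<Rightarrow> ('v, real) mfps" where
  "weighted_term r n m \<sigma> =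
     (\<Prod>i\<in>UNIV. mfps_rpow (det (weighted_perm_matrix n (\<lambda>j. mfps_X i ^ m j) \<sigma>)) (r i))"

text \<open>P n is \<open>weighted_sum r n (\<lambda>_. 1)\<close>, and G n w is
  \<open>weighted_sum r (Suc n) ((\<lambda>_. 1)(n := w))\<close>.\<close>

definition weighted_sum ::
  "('v::finite \<Rightarrow> real) \<Rightarrow> nat \<Rightarrow> (nat \<Rightarrow> nat) \<Rightarrow> ('v, real) mfps" where
  "weighted_sum r n m = (\<Sum>\<sigma> | \<sigma> permutes {..<n}. weighted_term r n m \<sigma>)"

lemma weighted_sum_cong:
  assumes "\<And>i. i < n \<Longrightarrow> m i = m' i"
  shows "weighted_sum r n m = weighted_sum r n m'"
proof -
  have "weighted_perm_matrix n (\<lambda>j. mfps_X i ^ m j) \<sigma> =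
      weighted_perm_matrix n (\<lambda>j. mfps_X i ^ m' j :: ('a, real) mfps) \<sigma>" for i \<sigma>
    by (intro eq_matI) (auto simp: assms)
  then show ?thesis
    by (simp add: weighted_sum_def weighted_term_def)
qed

text \<open>Conjugation by \<open>p\<close> permutes the summands, so it does not matter which point
  carries which weight.\<close>

lemma weighted_sum_permute:
  assumes p: "p permutes {..<n}"
  shows "weighted_sum r n (m \<circ> p) = weighted_sum r n m"
proof -
  have "weighted_term r n (m \<circ> p) (Hilbert_Choice.inv p \<circ> \<tau> \<circ> p) = weighted_term r n m \<tau>" for \<tau>
    using det_weighted_conj[OF p, of "\<lambda>j. mfps_X i ^ m j :: ('a, real) mfps" \<tau> for i]
    by (simp add: weighted_term_def comp_def[of _ p])
  moreover have "bij_betw (\<lambda>\<tau>. Hilbert_Choice.inv p \<circ> \<tau> \<circ> p)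
      {\<tau>. \<tau> permutes {..<n}} {\<tau>. \<tau> permutes {..<n}}"
    by (rule bij_betw_byWitness[where f' = "\<lambda>\<sigma>. p \<circ> \<sigma> \<circ> Hilbert_Choice.inv p"])
      (auto simp: fun_eq_iff permutes_inverses[OF p] intro!: permutes_compose p permutes_inv)
  ultimately show ?thesis
    unfolding weighted_sum_def
    by (subst sum.reindex_bij_betw[symmetric]) (assumption, simp only:)
qed

lemma mfps_X_power_const_term:
  "k > 0 \<Longrightarrow> mfps_nth (mfps_X i ^ k :: ('v::finite, 'a::comm_ring_1) mfps) (\<lambda>_. 0) = 0"
  by (simp add: mfps_const_term.hom_power mfps_X.rep_eq fun_eq_iff power_0_left)

lemma weighted_sum_Suc:
  assumes m: "\<And>i. m i > 0"
  shows "weighted_sum r (Suc n) m = h_series r (\<lambda>i. mfps_X i ^ m n) * weighted_sum r n m +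
           (\<Sum>b<n. weighted_sum r n (m(b := m b + m n)))"
proof -
  have fixed: "weighted_term r (Suc n) m \<tau> = h_series r (\<lambda>i. mfps_X i ^ m n) * weighted_term r n m \<tau>"
    if "\<tau> permutes {..<n}" for \<tau>
  proof -
    \<comment> \<open>Positive weights give both factors constant term 1, as
      \<open>mfps_rpow_mult\<close> requires.\<close>
    have "mfps_nth (1 - mfps_X i ^ m n :: ('a, real) mfps) (\<lambda>_. 0) = 1" for i
      using m by (simp add: minus_mfps.rep_eq one_mfps.rep_eq mfps_X_power_const_term)
    then show ?thesis
      using m that unfolding weighted_term_def h_series_def
      by (simp add: det_weighted_fixed mfps_rpow_mult det_weighted_const_term
          mfps_X_power_const_term prod.distrib)
  qed
  have contract: "weighted_term r (Suc n) m (transpose n b \<circ> \<tau>) =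
      weighted_term r n (m(b := m b + m n)) \<tau>" if "\<tau> permutes {..<n}" "b < n" for \<tau> b
  proof -
    have "(\<lambda>j. mfps_X i ^ m j)(b := mfps_X i ^ m b * mfps_X i ^ m n) =
        (\<lambda>j. mfps_X i ^ (m(b := m b + m n)) j :: ('a, real) mfps)" for i
      by (auto simp: power_add)
    then show ?thesis
      by (simp only: weighted_term_def det_weighted_contract[OF that])
  qed
  have "weighted_sum r (Suc n) m =
      (\<Sum>b\<in>insert n {..<n}. \<Sum>\<tau> | \<tau> permutes {..<n}. weighted_term r (Suc n) m (transpose n b \<circ> \<tau>))"
    unfolding weighted_sum_def lessThan_Suc by (rule sum_over_permutations_insert) auto
  \<comment> \<open>For \<open>b = n\<close> the transposition is the identity, leaving \<tau>
    itself.\<close>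
  also have "\<dots> = (\<Sum>\<tau> | \<tau> permutes {..<n}. weighted_term r (Suc n) m \<tau>) +
      (\<Sum>b<n. \<Sum>\<tau> | \<tau> permutes {..<n}. weighted_term r (Suc n) m (transpose n b \<circ> \<tau>))"
    by simp
  also have "\<dots> = h_series r (\<lambda>i. mfps_X i ^ m n) * weighted_sum r n m +
      (\<Sum>b<n. weighted_sum r n (m(b := m b + m n)))"
    by (simp add: weighted_sum_def sum_distrib_left fixed contract)
  finally show ?thesis .
qed

text \<open>Contracting the last point into any of the \<open>n + 1\<close> others leaves a single
  weight \<open>w + 1\<close> among ones; by symmetry it can be moved to \<open>n\<close>, so all
  these summands agree.\<close>

lemma weighted_sum_Suc_Suc:
  assumes "w > 0"
  shows "weighted_sum r (Suc (Suc n)) ((\<lambda>_. 1)(Suc n := w)) =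
    h_series r (\<lambda>i. mfps_X i ^ w) * weighted_sum r (Suc n) (\<lambda>_. 1) +
    of_nat (Suc n) * weighted_sum r (Suc n) ((\<lambda>_. 1)(n := w + 1))"
proof -
  have "weighted_sum r (Suc n) (((\<lambda>_. 1)(Suc n := w))(b := 1 + w)) =
      weighted_sum r (Suc n) ((\<lambda>_. 1)(n := w + 1))" if "b < Suc n" for b
  proof -
    have "weighted_sum r (Suc n) (((\<lambda>_. 1)(Suc n := w))(b := 1 + w)) =
        weighted_sum r (Suc n) (((\<lambda>_. 1)(n := w + 1)) \<circ> transpose b n)"
      using that by (intro weighted_sum_cong) (auto simp: transpose_def)
    also have "\<dots> = weighted_sum r (Suc n) ((\<lambda>_. 1)(n := w + 1))"
      using that by (intro weighted_sum_permute permutes_swap_id) auto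
    finally show ?thesis .
  qed
  moreover have "weighted_sum r (Suc n) ((\<lambda>_. 1)(Suc n := w)) = weighted_sum r (Suc n) (\<lambda>_. 1)"
    by (intro weighted_sum_cong) auto
  ultimately show ?thesis
    using assms by (subst weighted_sum_Suc) (simp_all del: sum.lessThan_Suc of_nat_Suc)
qed

lemma Q_series_eq_weighted_sum:
  "Q_series r n = mfps_const (1 / fact n) * weighted_sum r n (\<lambda>_. 1)"
proof (cases "n = 0")
  case True
  \<comment> \<open>Only the identity permutes the empty set, and the empty determinant is 1,
    matching the convention for Q at 0.\<close>
  then show ?thesis
    by (simp add: Q_series_def weighted_sum_def weighted_term_def mfps_rpow_1 mfps_const_1)
next
  case False
  have "1\<^sub>m n - mfps_X i \<cdot>\<^sub>m perm_matrix n \<sigma> =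
      weighted_perm_matrix n (\<lambda>j. mfps_X i :: ('a, real) mfps) \<sigma>" for i \<sigma>
    by (intro eq_matI) (auto simp: perm_matrix_def)
  then show ?thesis
    using False by (simp add: Q_series_def weighted_sum_def weighted_term_def)
qed

text \<open>Dividing by \<open>fact n\<close> absorbs the factor \<open>n + 1\<close> of the
  recursion and turns each P into a Q. Each step raises the weight by one, hence the induction over
  all \<open>w\<close>.\<close>

lemma weighted_sum_expansion:
  assumes "w > 0"
  shows "mfps_const (1 / fact n) * weighted_sum r (Suc n) ((\<lambda>_. 1)(n := w)) =
    (\<Sum>j\<le>n. h_series r (\<lambda>i. mfps_X i ^ (w + j)) * Q_series r (n - j))"
  using assms
proof (induction n arbitrary: w)
  case 0
  have "weighted_sum r 0 ((\<lambda>_. 1)(0 := w)) = weighted_sum r 0 (\<lambda>_. 1)"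
    by (intro weighted_sum_cong) auto
  then show ?case
    using 0 by (subst weighted_sum_Suc) (auto simp: Q_series_eq_weighted_sum mfps_const_1)
next
  case (Suc n)
  have e: "1 / fact n = 1 / fact (Suc n) * real (Suc n)"
    by (simp del: of_nat_Suc)
  have c: "(mfps_const (1 / fact n) :: ('a, real) mfps) =
      mfps_const (1 / fact (Suc n)) * of_nat (Suc n)"
    by (simp only: e mfps_const_mult mfps_const_of_nat)
  have "mfps_const (1 / fact (Suc n)) * weighted_sum r (Suc (Suc n)) ((\<lambda>_. 1)(Suc n := w)) =
      h_series r (\<lambda>i. mfps_X i ^ w) * Q_series r (Suc n) +
      mfps_const (1 / fact n) * weighted_sum r (Suc n) ((\<lambda>_. 1)(n := w + 1))"
    unfolding weighted_sum_Suc_Suc[OF Suc.prems] Q_series_eq_weighted_sum c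
    by (simp only: algebra_simps)
  also have "mfps_const (1 / fact n) * weighted_sum r (Suc n) ((\<lambda>_. 1)(n := w + 1)) =
      (\<Sum>j\<le>n. h_series r (\<lambda>i. mfps_X i ^ (w + 1 + j)) * Q_series r (n - j))"
    by (rule Suc.IH) simp
  finally show ?case
    unfolding sum.atMost_Suc_shift by simp
qed

theorem corollary1p4:
  fixes r :: "'v::finite \<Rightarrow> real" and n :: nat
  assumes "n \<ge> 1"
  shows "Q_series r n = mfps_const (1 / real n) *
           (\<Sum>k=1..n. h_series r (\<lambda>i. mfps_X i ^ k) * Q_series r (n - k))"
proof -
  obtain l where n: "n = Suc l"
    using assms by (cases n) auto
  \<comment> \<open>Unit weights are the case \<open>w = 1\<close>: updating \<open>l\<close> to 1
    changes nothing, and \<open>fact n = n * fact l\<close>.\<close>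
  have "Q_series r n = mfps_const (1 / real n * (1 / fact l)) * weighted_sum r n ((\<lambda>_. 1)(l := 1))"
    by (simp add: Q_series_eq_weighted_sum n fun_upd_idem)
  also have "\<dots> = mfps_const (1 / real n) *
      (mfps_const (1 / fact l) * weighted_sum r (Suc l) ((\<lambda>_. 1)(l := 1)))"
    unfolding mfps_const_mult n by (rule mult.assoc)
  also have "mfps_const (1 / fact l) * weighted_sum r (Suc l) ((\<lambda>_. 1)(l := 1)) =
      (\<Sum>j\<le>l. h_series r (\<lambda>i. mfps_X i ^ (1 + j)) * Q_series r (l - j))"
    by (rule weighted_sum_expansion) simp
  also have "\<dots> = (\<Sum>k=1..n. h_series r (\<lambda>i. mfps_X i ^ k) * Q_series r (n - k))"
    by (rule sum.reindex_bij_witness[where i = "\<lambda>k. k - 1" and j = Suc]) (auto simp: n)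
  finally show ?thesis .
qed

end
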